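(* (Dobinski-like formula.) For all integers $n\ge0$ and $p\ge0$, \[ \mathrm{Bel}_{n,\lambda}^{(p)}=\sum_{k=0}^{\infty}\sum_{l=0}^{\infty}(-1)^{l}\frac{\binom{k+l}{l}}{\binom{k+l+p}{p}}\frac{(k)_{n,\lambda}}{(k+l)!}. \]
   Context: Let $\lambda\in\mathbb{R}$. Set $(x)_{0,\lambda}=1$, $(x)_{n,\lambda}=x(x-\lambda)\cdots(x-(n-1)\lambda)$ for $n\ge1$. The degenerate exponential is the formal power series $e_\lambda^x(t)=\sum_{n\ge0}(x)_{n,\lambda}\frac{t^n}{n!}$ ($=(1+\lambda t)^{x/\lambda}$, and $e^{xt}$ if $\lambda=0$), $e_\lambda(t)=e_\lambda^1(t)$. For an integer $p\ge0$, the truncated degenerate Bell numbers $\mathrm{Bel}^{(p)}_{n,\lambda}$ are defined by $\sum_{n\ge0}\mathrm{Bel}^{(p)}_{n,\lambda}\frac{t^n}{n!}=\frac{p!}{(e_\lambda(t)-1)^p}\Big(e^{e_\lambda(t)-1}-\sum_{k=0}^{p-1}\frac{(e_\lambda(t)-1)^k}{k!}\Big)=p!\sum_{k\ge0}\frac{(e_\lambda(t)-1)^k}{(k+p)!}$. *)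

theory Defs
  imports "HOL-Analysis.Analysis" "HOL-Computational_Algebra.Computational_Algebra"
begin

definition degen_fact :: "real \<Rightarrow> real \<Rightarrow> nat \<Rightarrow> real" where
  "degen_fact lam x n = (\<Prod>i<n. x - real i * lam)"

definition degen_exp :: "real \<Rightarrow> real \<Rightarrow> real fps" where
  "degen_exp lam x = Abs_fps (\<lambda>n. degen_fact lam x n / fact n)"

text \<open>The division below is division of formal power series. It is exact: both the
  numerator and the denominator have order of vanishing at least \<open>p\<close> at \<open>0\<close>, and that of
  the denominator is exactly \<open>p\<close>; see \<open>trunc_degen_Bell_gf_altdef\<close> below.\<close>

definition trunc_degen_Bell_gf :: "real \<Rightarrow> nat \<Rightarrow> real fps" where
  "trunc_degen_Bell_gf lam p =
     fps_const (fact p) *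
       (fps_compose (fps_exp 1) (degen_exp lam 1 - 1)
          - (\<Sum>k<p. fps_const (1 / fact k) * (degen_exp lam 1 - 1) ^ k))
     / (degen_exp lam 1 - 1) ^ p"

definition trunc_degen_Bell :: "real \<Rightarrow> nat \<Rightarrow> nat \<Rightarrow> real" where
  "trunc_degen_Bell lam p n = fact n * fps_nth (trunc_degen_Bell_gf lam p) n"

lemma degen_exp_minus_one_nth:
  "fps_nth (degen_exp lam 1 - 1) 0 = 0" "fps_nth (degen_exp lam 1 - 1) (Suc 0) = 1"
  by (simp_all add: degen_exp_def degen_fact_def)

text \<open>The series form \<open>p! \<Sum>\<^sub>k (e\<^sub>\<lambda>(t) - 1)\<^sup>k / (k + p)!\<close> of the generating function.\<close>

lemma trunc_degen_Bell_gf_altdef: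
  "trunc_degen_Bell_gf lam p =
     fps_compose (Abs_fps (\<lambda>k. fact p / fact (k + p))) (degen_exp lam 1 - 1)"
proof -
  define F where "F = degen_exp lam 1 - 1"
  define H :: "real fps" where "H = fps_shift p (fps_exp 1)"
  have F0: "fps_nth F 0 = 0" and "F \<noteq> 0"
    using degen_exp_minus_one_nth[of lam] by (auto simp: F_def)
  have cut: "(\<Sum>k<p. fps_const (1 / fact k) * fps_X ^ k) = fps_cutoff p (fps_exp (1::real))"
    by (rule fps_ext) (auto simp: fps_sum_nth fps_X_power_nth if_distrib
        cong: if_cong)
  have X: "fps_X oo F = F" using F0 by simp
  have "fps_exp 1 = H * fps_X ^ p + (\<Sum>k<p. fps_const (1 / fact k) * fps_X ^ k)"
    unfolding cut H_def by (simp add: fps_shift_cutoff)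
  then have "fps_exp 1 oo F
      = (H * fps_X ^ p + (\<Sum>k<p. fps_const (1 / fact k) * fps_X ^ k)) oo F"
    by (rule arg_cong)
  also have "\<dots> = (H oo F) * F ^ p + (\<Sum>k<p. fps_const (1 / fact k) * F ^ k)"
    using F0 by (simp add: fps_compose_add_distrib fps_compose_sum_distrib
        fps_compose_mult_distrib flip: fps_compose_power)
  finally have "trunc_degen_Bell_gf lam p = fps_const (fact p) * ((H oo F) * F ^ p) / F ^ p"
    unfolding trunc_degen_Bell_gf_def F_def[symmetric] by simp
  also have "\<dots> = fps_const (fact p) * (H oo F)"
    using \<open>F \<noteq> 0\<close> by (simp flip: mult.assoc)
  also have "\<dots> = (fps_const (fact p) * H) oo F"
    using F0 by (simp add: fps_compose_mult_distrib)
  also have "fps_const (fact p) * H = Abs_fps (\<lambda>k. fact p / fact (k + p))"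
    by (rule fps_ext) (simp add: H_def)
  finally show ?thesis unfolding F_def .
qed

end

theory Submission
  imports Defs
begin

text \<open>
  The coefficient of \<open>t\<^sup>n / n!\<close> in \<open>(e\<^sub>\<lambda>(t) - 1)\<^sup>m\<close> is, by the binomial theorem and
  \<open>e\<^sub>\<lambda>(t)\<^sup>k = e\<^sub>\<lambda>\<^sup>k(t)\<close>, the \<open>n\<close>-th backward sum \<open>\<Sum>k\<le>m. (-1)\<^sup>m\<^sup>-\<^sup>k (m choose k) (k)\<^sub>n\<^sub>,\<^sub>\<lambda>\<close>.
  Hence the Bell number is the sum of the double series along the diagonals \<open>k + l = m\<close>, of which
  only those with \<open>m \<le> n\<close> contribute. The double series is dominated by
  \<open>\<bar>(k)\<^sub>n\<^sub>,\<^sub>\<lambda>\<bar> / (k! l!)\<close> and so converges absolutely, which allows summing by rows instead.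
\<close>

lemma degen_fact_Suc: "degen_fact lam x (Suc n) = degen_fact lam x n * (x - real n * lam)"
  by (simp add: degen_fact_def)

text \<open>Comparing coefficients, the differential equation says
  \<open>(n + 1) * F_(n+1) = (x - n * lam) * F_n\<close>, so \<open>F_0\<close> determines
  \<open>F\<close>. This treats \<open>lam = 0\<close> uniformly, unlike the closed form
  \<open>(1 + lam * t) powr (x / lam)\<close>.\<close>

lemma fps_eq_degen_expI:
  fixes F :: "real fps"
  assumes ode: "(1 + fps_const lam * fps_X) * fps_deriv F = fps_const x * F"
    and init: "fps_nth F 0 = 1"
  shows "F = degen_exp lam x"
proof (rule fps_ext)
  fix n
  show "fps_nth F n = fps_nth (degen_exp lam x) n"
  proof (induction n)
    case 0
    then show ?case using init by (simp add: degen_exp_def degen_fact_def)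
  next
    case (Suc n)
    have "fps_nth ((1 + fps_const lam * fps_X) * fps_deriv F) n = x * fps_nth F n"
      by (simp add: ode)
    then have "real (Suc n) * fps_nth F (Suc n) = (x - real n * lam) * fps_nth F n"
      \<comment> \<open>Multiplication by \<open>fps_X\<close> shifts coefficients by one, with
        value 0 at index 0; hence the case split.\<close>
      by (cases n) (simp_all add: algebra_simps)
    then have "fps_nth F (Suc n) = (x - real n * lam) * fps_nth F n / real (Suc n)"
      by (simp add: field_simps)
    then show ?case
      by (simp add: Suc.IH degen_exp_def degen_fact_Suc mult_ac)
  qed
qed

lemma degen_exp_ode:
  "(1 + fps_const lam * fps_X) * fps_deriv (degen_exp lam x) = fps_const x * degen_exp lam x"
proof (rule fps_ext)
  fix n
  have "real (Suc n) * fps_nth (degen_exp lam x) (Suc n)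
      = (x - real n * lam) * fps_nth (degen_exp lam x) n"
    by (simp add: degen_exp_def degen_fact_Suc field_simps del: of_nat_Suc)
  then show "fps_nth ((1 + fps_const lam * fps_X) * fps_deriv (degen_exp lam x)) n
      = fps_nth (fps_const x * degen_exp lam x) n"
    by (cases n) (simp_all add: algebra_simps)
qed

text \<open>By the product rule, the product solves the differential equation with parameter
  \<open>x + y\<close>.\<close>

lemma degen_exp_add: "degen_exp lam (x + y) = degen_exp lam x * degen_exp lam y"
proof (rule fps_eq_degen_expI[symmetric])
  let ?D = "1 + fps_const lam * fps_X" and ?E = "degen_exp lam"
  have "?D * fps_deriv (?E x * ?E y) = ?E x * (?D * fps_deriv (?E y)) + (?D * fps_deriv (?E x)) * ?E y"
    by (simp add: algebra_simps)
  also have "\<dots> = fps_const (x + y) * (?E x * ?E y)"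
    by (simp only: degen_exp_ode) (simp add: algebra_simps flip: fps_const_add)
  finally show "?D * fps_deriv (?E x * ?E y) = fps_const (x + y) * (?E x * ?E y)" .
qed (simp add: degen_exp_def degen_fact_def)

lemma degen_exp_0: "degen_exp lam 0 = 1"
  by (rule fps_eq_degen_expI[symmetric]) simp_all

lemma degen_exp_power: "degen_exp lam x ^ k = degen_exp lam (real k * x)"
  by (induction k) (simp_all add: degen_exp_0 degen_exp_add[symmetric] algebra_simps)

lemma fps_nth_degen_exp_minus_1_power:
  "fact n * fps_nth ((degen_exp lam 1 - 1) ^ m) n
     = (\<Sum>k\<le>m. (- 1) ^ (m - k) * real (m choose k) * degen_fact lam (real k) n)"
proof -
  have "(degen_exp lam 1 - 1) ^ m
      = (\<Sum>k\<le>m. of_nat (m choose k) * degen_exp lam 1 ^ k * (- 1) ^ (m - k))"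
    using binomial_ring[of "degen_exp lam 1" "- 1" m] by simp
  also have "\<dots> = (\<Sum>k\<le>m. fps_const ((- 1) ^ (m - k) * real (m choose k)) * degen_exp lam (real k))"
    by (intro sum.cong)
      (simp_all add: degen_exp_power mult_ac fps_of_nat flip: fps_const_mult fps_const_power fps_const_neg)
  finally show ?thesis
    by (simp add: fps_sum_nth degen_exp_def sum_distrib_left)
qed

text \<open>A single term of the exponential series is at most the whole sum, since all terms are
  nonnegative.\<close>

lemma power_le_fact_exp:
  fixes x :: real
  assumes "x \<ge> 0"
  shows "x ^ n \<le> fact n * exp x"
proof -
  have "(\<Sum>i\<in>{n}. inverse (fact i) * x ^ i) \<le> (\<Sum>i. inverse (fact i) * x ^ i)"
    using assms by (intro sum_le_suminf summable_exp) auto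
  then show ?thesis
    by (simp add: exp_def scaleR_conv_of_real field_simps)
qed

lemma summable_degen_fact_over_fact:
  "summable (\<lambda>k. \<bar>degen_fact lam (real k) n\<bar> / fact k)"
proof (rule summable_comparison_test')
  \<comment> \<open>Each of the \<open>n\<close> factors is at most
    \<open>k + n * \<bar>lam\<bar>\<close> in absolute value. Bounding the \<open>n\<close>-th power
    of this by \<open>fact n * exp (k + n * \<bar>lam\<bar>)\<close> and splitting off
    \<open>exp 1 ^ k\<close> leaves \<open>c\<close>, so the exponential series at
    \<open>exp 1\<close> dominates.\<close>
  define c where "c = fact n * exp (real n * \<bar>lam\<bar>)"
  show "summable (\<lambda>k. c * (inverse (fact k) * exp 1 ^ k))"
    by (intro summable_mult summable_exp)
  fix k :: nat
  have "\<bar>degen_fact lam (real k) n\<bar> = (\<Prod>i<n. \<bar>real k - real i * lam\<bar>)"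
    by (simp add: degen_fact_def abs_prod)
  also have "\<dots> \<le> (\<Prod>i<n. real k + real n * \<bar>lam\<bar>)"
  proof (intro prod_mono conjI)
    fix i assume "i \<in> {..<n}"
    then have "real i * \<bar>lam\<bar> \<le> real n * \<bar>lam\<bar>"
      by (intro mult_right_mono) auto
    moreover have "\<bar>real k - real i * lam\<bar> \<le> real k + real i * \<bar>lam\<bar>"
      using abs_triangle_ineq4[of "real k" "real i * lam"] by (simp add: abs_mult)
    ultimately show "\<bar>real k - real i * lam\<bar> \<le> real k + real n * \<bar>lam\<bar>"
      by linarith
  qed simp
  also have "\<dots> \<le> fact n * exp (real k + real n * \<bar>lam\<bar>)"
    using power_le_fact_exp[of "real k + real n * \<bar>lam\<bar>" n] by simp
  also have "\<dots> = c * exp 1 ^ k"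
    by (simp add: c_def exp_add mult_ac flip: exp_of_nat_mult)
  finally show "norm (\<bar>degen_fact lam (real k) n\<bar> / fact k) \<le> c * (inverse (fact k) * exp 1 ^ k)"
    by (simp add: field_simps)
qed

lemma summable_on_Times_mult:
  fixes a b :: "nat \<Rightarrow> real"
  assumes "summable a" "summable b" "\<And>k. a k \<ge> 0" "\<And>l. b l \<ge> 0"
  shows "(\<lambda>(k, l). a k * b l) summable_on UNIV \<times> UNIV"
proof (rule summable_on_SigmaI)
  show "((\<lambda>l. case (k, l) of (k, l) \<Rightarrow> a k * b l) has_sum (a k * suminf b)) UNIV" for k
    using assms by (auto intro!: has_sum_cmult_right norm_summable_imp_has_sum summable_sums)
  show "(\<lambda>k. a k * suminf b) summable_on UNIV"
    using assms by (intro summable_on_cmult_left norm_summable_imp_summable_on) simp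
qed (use assms in auto)

text \<open>The bijection \<open>(k, l) \<mapsto> (k + l, k)\<close> turns the quadrant into a
  family of finite fibres \<open>k \<le> m\<close>.\<close>

lemma has_sum_diagonals:
  fixes f :: "nat \<times> nat \<Rightarrow> real"
  assumes "f summable_on UNIV \<times> UNIV"
  shows "((\<lambda>m. \<Sum>k\<le>m. f (k, m - k)) has_sum infsum f (UNIV \<times> UNIV)) UNIV"
proof (rule has_sum_SigmaD)
  have "(f has_sum infsum f (UNIV \<times> UNIV)) (UNIV \<times> UNIV)"
    using assms by (rule has_sum_infsum)
  also have "?this \<longleftrightarrow>
      ((\<lambda>(m, k). f (k, m - k)) has_sum infsum f (UNIV \<times> UNIV)) (SIGMA m:UNIV. {..m})"
    by (rule has_sum_reindex_bij_witness[where i = "\<lambda>(m, k). (k, m - k)" and j = "\<lambda>(k, l). (k + l, k)"])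
      auto
  finally show "((\<lambda>(m, k). f (k, m - k)) has_sum infsum f (UNIV \<times> UNIV)) (SIGMA m:UNIV. {..m})" .
qed (auto intro: has_sum_finiteI)

theorem theorem4:
  fixes lam :: real and n p :: nat
  shows "(\<forall>k. summable (\<lambda>l. (- 1) ^ l
             * (real ((k + l) choose l) / real ((k + l + p) choose p))
             * (degen_fact lam (real k) n / fact (k + l))))
       \<and> (\<lambda>k. \<Sum>l. (- 1) ^ l
             * (real ((k + l) choose l) / real ((k + l + p) choose p))
             * (degen_fact lam (real k) n / fact (k + l)))
           sums trunc_degen_Bell lam p n"
proof -
  define T where "T k l = (- 1) ^ l
             * (real ((k + l) choose l) / real ((k + l + p) choose p))
             * (degen_fact lam (real k) n / fact (k + l))" for k l
  have T_bound: "norm (T k l) \<le> \<bar>degen_fact lam (real k) n\<bar> / fact k * inverse (fact l)" for k l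
  proof -
    have "real ((k + l) choose l) / fact (k + l) = inverse (fact k * fact l)"
      by (simp add: binomial_fact field_simps)
    then have "norm (T k l)
        = \<bar>degen_fact lam (real k) n\<bar> * inverse (fact k * fact l) / real ((k + l + p) choose p)"
      unfolding T_def by (simp add: abs_mult power_abs flip: times_divide_eq_left)
        (simp add: field_simps)
    also have "\<dots> \<le> \<bar>degen_fact lam (real k) n\<bar> * inverse (fact k * fact l) / 1"
      using zero_less_binomial[of p "k + l + p"] by (intro divide_left_mono) (auto simp: Suc_le_eq)
    finally show ?thesis by (simp add: field_simps)
  qed
  have "(\<lambda>(k, l). \<bar>degen_fact lam (real k) n\<bar> / fact k * inverse (fact l)) summable_on UNIV \<times> UNIV"
    using summable_exp[of "1 :: real"]
    by (intro summable_on_Times_mult summable_degen_fact_over_fact) simp_all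
  then have "(\<lambda>z. norm (case z of (k, l) \<Rightarrow> T k l)) summable_on UNIV \<times> UNIV"
    by (rule summable_on_comparison_test) (use T_bound in auto)
  then have summ: "(\<lambda>(k, l). T k l) summable_on UNIV \<times> UNIV"
    by (rule abs_summable_summable)
  define S where "S = infsum (\<lambda>(k, l). T k l) (UNIV \<times> UNIV)"
  \<comment> \<open>Unconditional summability of each row makes its ordinary series
    \<open>suminf\<close> the row sum.\<close>
  have row: "(T k has_sum (\<Sum>l. T k l)) UNIV" for k
    using has_sum_imp_sums has_sum_infsum[OF summable_on_SigmaD1[OF summ, of k]]
    by (metis UNIV_I sums_unique)
  have "((\<lambda>k. \<Sum>l. T k l) has_sum S) UNIV"
    by (rule has_sum_SigmaD[where f = "\<lambda>(k, l). T k l" and B = "\<lambda>_. UNIV"])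
      (use summ row in \<open>auto simp: S_def intro: has_sum_infsum\<close>)
  then have sums: "(\<lambda>k. \<Sum>l. T k l) sums S"
    by (rule has_sum_imp_sums)

  define F where "F = degen_exp lam 1 - 1"
  \<comment> \<open>\<open>F\<close> has no constant term, so \<open>F ^ m\<close> vanishes to order
    at least \<open>m\<close>.\<close>
  have F_pow: "fps_nth (F ^ m) n = 0" if "m > n" for m
    using startsby_zero_power_prefix[of F m] degen_exp_minus_one_nth(1) that by (auto simp: F_def)
  have diag: "(\<Sum>k\<le>m. T k (m - k)) = fact n * (fact p / fact (m + p) * fps_nth (F ^ m) n)" for m
  proof -
    \<comment> \<open>On the diagonal, the factor \<open>1 / (((m + p) choose p) * fact m)\<close>
      equals \<open>fact p / fact (m + p)\<close>, independent of \<open>k\<close>.\<close>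
    have "T k (m - k) = fact p / fact (m + p)
        * ((- 1) ^ (m - k) * real (m choose k) * degen_fact lam (real k) n)" if "k \<le> m" for k
      using that unfolding T_def binomial_symmetric[OF that]
      by (simp add: binomial_fact[of p "m + p"] field_simps)
    then have "(\<Sum>k\<le>m. T k (m - k)) = fact p / fact (m + p) * (fact n * fps_nth (F ^ m) n)"
      unfolding F_def fps_nth_degen_exp_minus_1_power sum_distrib_left by (intro sum.cong) auto
    then show ?thesis by (simp add: mult_ac)
  qed
  have "((\<lambda>m. \<Sum>k\<le>m. T k (m - k)) has_sum S) UNIV"
    using has_sum_diagonals[OF summ] by (simp add: S_def)
  moreover have "((\<lambda>m. \<Sum>k\<le>m. T k (m - k)) has_sum (\<Sum>m\<in>{0..n}. \<Sum>k\<le>m. T k (m - k))) UNIV"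
    by (rule has_sum_finite_neutralI) (auto simp: diag F_pow)
  ultimately have "S = (\<Sum>m\<in>{0..n}. \<Sum>k\<le>m. T k (m - k))"
    by (rule has_sum_unique)
  \<comment> \<open>The coefficient formula for a composition also sums over \<open>{0..n}\<close>,
    so the two sums agree term by term.\<close>
  also have "\<dots> = trunc_degen_Bell lam p n"
    by (simp add: diag trunc_degen_Bell_def trunc_degen_Bell_gf_altdef fps_compose_nth F_def
        sum_distrib_left)
  finally have "S = trunc_degen_Bell lam p n" .
  moreover have "summable (T k)" for k
    using has_sum_imp_sums[OF row] by (rule sums_summable)
  ultimately show ?thesis
    using sums unfolding T_def by simp
qed

end
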